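(* Let $h\in\mathbb{N}\setminus\{0\}$, and let $v$ be a value function and $\pi_h\in\mathcal{G}_h(v)$ be such that $(v,\pi_h)$ is $h$-greedy consistent. Then, for any integer $m\ge1$ and any $\lambda\in[0,1]$, $$\|v^*-(T^{\pi_h})^mT^{h-1}v\|_\infty\le\gamma^h\|v^*-v\|_\infty\quad\text{and}\quad\|v^*-T^{\pi_h}_\lambda T^{h-1}v\|_\infty\le\gamma^h\|v^*-v\|_\infty.$$
   Context: Setting: an infinite-horizon discounted Markov decision process $(\mathcal{S},\mathcal{A},P,R,\gamma)$ with finite state space $\mathcal{S}$, finite action space $\mathcal{A}$, transition kernel $P(s'\mid s,a)$, reward function $r(s,a)\in[R_{\min},R_{\max}]$ and discount factor $\gamma\in(0,1)$. A policy is a stationary map $\pi:\mathcal{S}\to\mathcal{P}(\mathcal{A})$ into probability distributions on $\mathcal{A}$. Let $[P^\pi]_{s,s'}=P(s'\mid s,\pi(s))$ and $[r^\pi]_s=r(s,\pi(s))$ (averaged over the action distribution $\pi(s)$). The value of $\pi$ is $v^\pi=(I-\gamma P^\pi)^{-1}r^\pi$, and the optimal value is $v^*=\max_\pi v^\pi$ (component-wise). A value function is a vector $v\in\mathbb{R}^{|\mathcal S|}$; inequalities between vectors are component-wise. Bellman operators: $T^\pi v=r^\pi+\gamma P^\pi v$ and $Tv=\max_\pi T^\pi v$ (component-wise); $T^{j}$ is the $j$-fold iterate, with $T^0$ the identity. $\lambda$-return operator: for $\lambda\in[0,1]$, $T^\pi_\lambda v=v+(I-\gamma\lambda P^\pi)^{-1}(T^\pi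 v-v)$, which for $\lambda<1$ equals $(1-\lambda)\sum_{j=0}^\infty\lambda^j(T^\pi)^{j+1}v$. $h$-greedy policies: $\mathcal{G}_h(v)=\{\pi: T^\pi T^{h-1}v=T^hv\}$. $h$-greedy consistency: a pair $(v,\pi)$ is $h$-greedy consistent if $T^\pi T^{h-1}v\ge T^{h-1}v$. *)

theory Defs
  imports "HOL-Analysis.Analysis" "HOL-Probability.Probability"
begin

text \<open>
  Finite state and action spaces are types of class \<open>finite\<close>; the transition kernel is
  \<open>P :: 's \<Rightarrow> 'a \<Rightarrow> 's pmf\<close> and a stationary stochastic policy is \<open>\<pi> :: 's \<Rightarrow> 'a pmf\<close>.
  Value functions are vectors \<open>real ^ 's\<close>, whose library order is the component-wise one.
\<close>

definition policy_kernel ::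
    "('s::finite \<Rightarrow> 'a::finite \<Rightarrow> 's pmf) \<Rightarrow> ('s \<Rightarrow> 'a pmf) \<Rightarrow> real ^ 's ^ 's" where
  "policy_kernel P \<pi> = (\<chi> s s'. \<Sum>a\<in>UNIV. pmf (\<pi> s) a * pmf (P s a) s')"

definition policy_reward ::
    "('s::finite \<Rightarrow> 'a::finite \<Rightarrow> real) \<Rightarrow> ('s \<Rightarrow> 'a pmf) \<Rightarrow> real ^ 's" where
  "policy_reward r \<pi> = (\<chi> s. \<Sum>a\<in>UNIV. pmf (\<pi> s) a * r s a)"

definition policy_value ::
    "('s::finite \<Rightarrow> 'a::finite \<Rightarrow> 's pmf) \<Rightarrow> ('s \<Rightarrow> 'a \<Rightarrow> real) \<Rightarrow> real \<Rightarrow> ('s \<Rightarrow> 'a pmf) \<Rightarrow> real ^ 's" where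
  "policy_value P r \<gamma> \<pi> =
     matrix_inv (mat 1 - \<gamma> *\<^sub>R policy_kernel P \<pi>) *v policy_reward r \<pi>"

text \<open>
  The policies form an infinite set, so the component-wise maxima over all policies are
  written as suprema of reals; for discount factors in \<open>(0,1)\<close> they are attained.
\<close>

definition optimal_value ::
    "('s::finite \<Rightarrow> 'a::finite \<Rightarrow> 's pmf) \<Rightarrow> ('s \<Rightarrow> 'a \<Rightarrow> real) \<Rightarrow> real \<Rightarrow> real ^ 's" where
  "optimal_value P r \<gamma> = (\<chi> s. SUP \<pi>. policy_value P r \<gamma> \<pi> $ s)"

definition bellman_policy ::
    "('s::finite \<Rightarrow> 'a::finite \<Rightarrow> 's pmf) \<Rightarrow> ('s \<Rightarrow> 'a \<Rightarrow> real) \<Rightarrow> real \<Rightarrow> ('s \<Rightarrow> 'a pmf)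
      \<Rightarrow> real ^ 's \<Rightarrow> real ^ 's" where
  "bellman_policy P r \<gamma> \<pi> v = policy_reward r \<pi> + \<gamma> *\<^sub>R (policy_kernel P \<pi> *v v)"

definition bellman_optimal ::
    "('s::finite \<Rightarrow> 'a::finite \<Rightarrow> 's pmf) \<Rightarrow> ('s \<Rightarrow> 'a \<Rightarrow> real) \<Rightarrow> real \<Rightarrow> real ^ 's \<Rightarrow> real ^ 's" where
  "bellman_optimal P r \<gamma> v = (\<chi> s. SUP \<pi>. bellman_policy P r \<gamma> \<pi> v $ s)"

definition lambda_return ::
    "('s::finite \<Rightarrow> 'a::finite \<Rightarrow> 's pmf) \<Rightarrow> ('s \<Rightarrow> 'a \<Rightarrow> real) \<Rightarrow> real \<Rightarrow> real \<Rightarrow> ('s \<Rightarrow> 'a pmf)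
      \<Rightarrow> real ^ 's \<Rightarrow> real ^ 's" where
  "lambda_return P r \<gamma> l \<pi> v =
     v + matrix_inv (mat 1 - (\<gamma> * l) *\<^sub>R policy_kernel P \<pi>) *v (bellman_policy P r \<gamma> \<pi> v - v)"

definition greedy_policies ::
    "('s::finite \<Rightarrow> 'a::finite \<Rightarrow> 's pmf) \<Rightarrow> ('s \<Rightarrow> 'a \<Rightarrow> real) \<Rightarrow> real \<Rightarrow> nat \<Rightarrow> real ^ 's
      \<Rightarrow> ('s \<Rightarrow> 'a pmf) set" where
  "greedy_policies P r \<gamma> h v =
     {\<pi>. bellman_policy P r \<gamma> \<pi> ((bellman_optimal P r \<gamma> ^^ (h - 1)) v) =
          (bellman_optimal P r \<gamma> ^^ h) v}"

definition greedy_consistent ::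
    "('s::finite \<Rightarrow> 'a::finite \<Rightarrow> 's pmf) \<Rightarrow> ('s \<Rightarrow> 'a \<Rightarrow> real) \<Rightarrow> real \<Rightarrow> nat \<Rightarrow> real ^ 's
      \<Rightarrow> ('s \<Rightarrow> 'a pmf) \<Rightarrow> bool" where
  "greedy_consistent P r \<gamma> h v \<pi> \<longleftrightarrow>
     bellman_policy P r \<gamma> \<pi> ((bellman_optimal P r \<gamma> ^^ (h - 1)) v)
       \<ge> (bellman_optimal P r \<gamma> ^^ (h - 1)) v"

end

theory Submission
  imports Defs
begin

text \<open>
  For \<open>w = T\<^sup>h\<^sup>-\<^sup>1 v\<close>, greedy consistency reads \<open>w \<le> T\<^sup>\<pi> w = T\<^sup>h v\<close>, so both \<open>(T\<^sup>\<pi>)\<^sup>m w\<close> and the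
  \<open>\<lambda>\<close>-return of \<open>w\<close> lie between \<open>T\<^sup>h v\<close> and \<open>v\<^sup>\<pi> \<le> v\<^sup>*\<close>. Hence their distance to \<open>v\<^sup>*\<close> is at most that of
  \<open>T\<^sup>h v\<close>, and \<open>T\<close> is a \<open>\<gamma>\<close>-contraction with fixed point \<open>v\<^sup>*\<close>. All comparisons of values come
  from one minimum principle: \<open>x \<ge> c P\<^sup>\<pi> x\<close> with \<open>0 \<le> c < 1\<close> forces \<open>x \<ge> 0\<close>.
\<close>

section \<open>Sup norm, matrices and inverses\<close>

lemma infnorm_cart_le:
  fixes x :: "real ^ 'n::finite"
  assumes "\<And>i. \<bar>x $ i\<bar> \<le> b"
  shows "infnorm x \<le> b"
  unfolding infnorm_cart by (rule cSup_least) (use assms in auto)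

lemma matrix_vector_mult_minus_right:
  fixes A :: "real ^ 'n ^ 'm"
  shows "A *v (- x) = - (A *v x)"
  using matrix_vector_mult_diff_distrib[of A 0 x] by simp

lemma matrix_inv_right:
  fixes A :: "'a::semiring_1 ^ 'n ^ 'm"
  assumes "invertible A"
  shows "A ** matrix_inv A = mat 1"
  using someI_ex[OF assms[unfolded invertible_def]] by (simp add: matrix_inv_def)

section \<open>Stochastic kernels and the minimum principle\<close>

lemma policy_kernel_nonneg: "0 \<le> policy_kernel P \<pi> $ s $ s'"
  by (simp add: policy_kernel_def sum_nonneg)

lemma policy_kernel_row_sum:
  fixes P :: "'s::finite \<Rightarrow> 'a::finite \<Rightarrow> 's pmf"
  shows "(\<Sum>s'\<in>UNIV. policy_kernel P \<pi> $ s $ s') = 1"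
proof -
  have "(\<Sum>s'\<in>UNIV. policy_kernel P \<pi> $ s $ s')
      = (\<Sum>a\<in>UNIV. pmf (\<pi> s) a * (\<Sum>s'\<in>UNIV. pmf (P s a) s'))"
    unfolding policy_kernel_def by (simp add: sum_distrib_left) (rule sum.swap)
  then show ?thesis
    by (simp add: sum_pmf_eq_1)
qed

text \<open>Rows of the kernel are probability distributions, so every component of the product is
  an average of \<open>x\<close>.\<close>

lemma policy_kernel_lower_bound:
  assumes "\<And>s'. b \<le> x $ s'"
  shows "b \<le> (policy_kernel P \<pi> *v x) $ s"
proof -
  have "b = (\<Sum>s'\<in>UNIV. policy_kernel P \<pi> $ s $ s' * b)"
    by (simp add: policy_kernel_row_sum flip: sum_distrib_right)
  also have "\<dots> \<le> (\<Sum>s'\<in>UNIV. policy_kernel P \<pi> $ s $ s' * x $ s')"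
    by (intro sum_mono mult_left_mono assms policy_kernel_nonneg)
  finally show ?thesis
    by (simp add: matrix_vector_mult_def)
qed

lemma policy_kernel_nonneg_vector:
  assumes "0 \<le> x"
  shows "0 \<le> policy_kernel P \<pi> *v x"
  using assms by (auto simp: less_eq_vec_def intro: policy_kernel_lower_bound)

lemma policy_kernel_le_infnorm: "(policy_kernel P \<pi> *v x) $ s \<le> infnorm x"
proof -
  have "- infnorm x \<le> (- x) $ s'" for s'
    using component_le_infnorm_cart[of x s'] by simp
  \<comment> \<open>An upper bound for \<open>x\<close> is a lower bound for
    \<open>- x\<close>.\<close>
  from policy_kernel_lower_bound[of "- infnorm x" "- x", OF this] show ?thesis
    by (metis matrix_vector_mult_minus_right neg_le_iff_le vector_uminus_component)
qed

text \<open>At a state \<open>s\<close> where \<open>x\<close> is smallest, the average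
  \<open>(policy_kernel P \<pi> *v x) $ s\<close> is at least \<open>x $ s\<close>. The hypothesis
  then gives \<open>(1 - c) * x $ s \<ge> 0\<close>, so even the smallest component is
  nonnegative.\<close>

lemma minimum_principle:
  assumes c: "0 \<le> c" "c < 1" and x: "c *\<^sub>R (policy_kernel P \<pi> *v x) \<le> x"
  shows "0 \<le> x"
proof -
  define s where "s = arg_min_on (($) x) UNIV"
  have min: "x $ s \<le> x $ s'" for s'
    unfolding s_def by (rule arg_min_least) auto
  have "c * x $ s \<le> c * (policy_kernel P \<pi> *v x) $ s"
    by (intro mult_left_mono policy_kernel_lower_bound min c)
  also have "\<dots> \<le> x $ s"
    using x by (simp add: less_eq_vec_def)
  finally have "0 \<le> (1 - c) * x $ s"
    by (simp add: algebra_simps)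
  with c have "0 \<le> x $ s"
    by (simp add: zero_le_mult_iff)
  then show ?thesis
    using min by (auto simp: less_eq_vec_def intro: order_trans)
qed

section \<open>Resolvents of the kernel\<close>

lemma resolvent_mult_vector:
  fixes A :: "real ^ 'n::finite ^ 'n"
  shows "(mat 1 - c *\<^sub>R A) *v x = x - c *\<^sub>R (A *v x)"
  by (simp add: matrix_vector_mult_diff_rdistrib scaleR_matrix_vector_assoc)

text \<open>The minimum principle, applied to a kernel vector and to its negative, makes the kernel
  trivial, which suffices for a square matrix.\<close>

lemma resolvent_invertible:
  assumes "0 \<le> c" "c < 1"
  shows "invertible (mat 1 - c *\<^sub>R policy_kernel P \<pi>)"
proof -
  have nonneg: "0 \<le> x" if "(mat 1 - c *\<^sub>R policy_kernel P \<pi>) *v x = 0" for x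
    using that assms by (intro minimum_principle[of c P \<pi>]) (auto simp: resolvent_mult_vector)
  have "x = 0" if "(mat 1 - c *\<^sub>R policy_kernel P \<pi>) *v x = 0" for x
    using nonneg[of x] nonneg[of "- x"] that
    by (simp add: matrix_vector_mult_minus_right order_antisym)
  then show ?thesis
    unfolding invertible_left_inverse matrix_left_invertible_ker by blast
qed

text \<open>Replaces the matrix inverse by a fixed-point equation, the form in which policy values
  and \<lambda>-returns are compared below.\<close>

lemma resolvent_solution:
  fixes P :: "'s::finite \<Rightarrow> 'a::finite \<Rightarrow> 's pmf" and \<pi> :: "'s \<Rightarrow> 'a pmf" and d :: "real ^ 's"
  assumes "0 \<le> c" "c < 1"
  defines "y \<equiv> matrix_inv (mat 1 - c *\<^sub>R policy_kernel P \<pi>) *v d"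
  shows "y = d + c *\<^sub>R (policy_kernel P \<pi> *v y)"
proof -
  have "(mat 1 - c *\<^sub>R policy_kernel P \<pi>) *v y = d"
    unfolding y_def
    by (simp add: matrix_vector_mul_assoc matrix_inv_right resolvent_invertible[OF assms(1,2)])
  then show ?thesis
    unfolding resolvent_mult_vector by (simp add: algebra_simps)
qed

section \<open>Bellman operator and value of a fixed policy\<close>

lemma bellman_policy_diff:
  "bellman_policy P r \<gamma> \<pi> u - bellman_policy P r \<gamma> \<pi> w = \<gamma> *\<^sub>R (policy_kernel P \<pi> *v (u - w))"
  by (simp add: bellman_policy_def matrix_vector_mult_diff_distrib scaleR_diff_right)

lemma bellman_policy_mono:
  assumes "0 \<le> \<gamma>" "u \<le> w"
  shows "bellman_policy P r \<gamma> \<pi> u \<le> bellman_policy P r \<gamma> \<pi> w"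
proof -
  have "0 \<le> policy_kernel P \<pi> *v (w - u)"
    using assms by (intro policy_kernel_nonneg_vector) simp
  then have "0 \<le> bellman_policy P r \<gamma> \<pi> w - bellman_policy P r \<gamma> \<pi> u"
    unfolding bellman_policy_diff using assms(1) by (simp add: less_eq_vec_def)
  then show ?thesis
    by simp
qed

lemma bellman_policy_value:
  assumes "0 \<le> \<gamma>" "\<gamma> < 1"
  shows "bellman_policy P r \<gamma> \<pi> (policy_value P r \<gamma> \<pi>) = policy_value P r \<gamma> \<pi>"
  using resolvent_solution[OF assms, of P \<pi> "policy_reward r \<pi>"]
  by (simp add: bellman_policy_def policy_value_def)

text \<open>As the value is a fixed point, the difference
  \<open>u - policy_value P r \<gamma> \<pi>\<close> satisfies the premise of the minimum
  principle.\<close>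

lemma policy_value_le:
  assumes "0 \<le> \<gamma>" "\<gamma> < 1" "bellman_policy P r \<gamma> \<pi> u \<le> u"
  shows "policy_value P r \<gamma> \<pi> \<le> u"
proof -
  have "\<gamma> *\<^sub>R (policy_kernel P \<pi> *v (u - policy_value P r \<gamma> \<pi>)) \<le> u - policy_value P r \<gamma> \<pi>"
    using assms(3) by (simp add: bellman_policy_value[OF assms(1,2)] flip: bellman_policy_diff[of P r])
  from minimum_principle[OF assms(1,2) this] show ?thesis
    by simp
qed

lemma le_policy_value:
  assumes "0 \<le> \<gamma>" "\<gamma> < 1" "u \<le> bellman_policy P r \<gamma> \<pi> u"
  shows "u \<le> policy_value P r \<gamma> \<pi>"
proof -
  have "\<gamma> *\<^sub>R (policy_kernel P \<pi> *v (policy_value P r \<gamma> \<pi> - u)) \<le> policy_value P r \<gamma> \<pi> - u"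
    using assms(3) by (simp add: bellman_policy_value[OF assms(1,2)] flip: bellman_policy_diff[of P r])
  from minimum_principle[OF assms(1,2) this] show ?thesis
    by simp
qed

section \<open>Optimal Bellman operator and greedy policies\<close>

text \<open>Exhibits the component as the average of the action values at \<open>s\<close> under the
  distribution \<open>\<pi> s\<close>, which reduces maximisation over policies to maximisation over
  actions.\<close>

lemma bellman_policy_component:
  "bellman_policy P r \<gamma> \<pi> v $ s
    = (\<Sum>a\<in>UNIV. pmf (\<pi> s) a * (r s a + \<gamma> * (\<Sum>s'\<in>UNIV. pmf (P s a) s' * v $ s')))"
proof -
  have "(policy_kernel P \<pi> *v v) $ s
      = (\<Sum>s'\<in>UNIV. \<Sum>a\<in>UNIV. pmf (\<pi> s) a * (pmf (P s a) s' * v $ s'))"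
    by (simp add: policy_kernel_def matrix_vector_mult_def sum_distrib_right mult.assoc)
  also have "\<dots> = (\<Sum>a\<in>UNIV. pmf (\<pi> s) a * (\<Sum>s'\<in>UNIV. pmf (P s a) s' * v $ s'))"
    by (subst sum.swap) (simp add: sum_distrib_left)
  finally show ?thesis
    by (simp add: bellman_policy_def policy_reward_def distrib_left sum.distrib
        sum_distrib_left mult.left_commute)
qed

text \<open>An average of action values never exceeds the largest one. The best action can be chosen
  separately in each state, so a single policy dominates in all components at once.\<close>

lemma deterministic_greedy_policy:
  fixes P :: "'s::finite \<Rightarrow> 'a::finite \<Rightarrow> 's pmf"
  obtains f :: "'s \<Rightarrow> 'a" where
    "\<And>\<pi>. bellman_policy P r \<gamma> \<pi> v \<le> bellman_policy P r \<gamma> (\<lambda>s. return_pmf (f s)) v"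
proof
  define q where "q s a = r s a + \<gamma> * (\<Sum>s'\<in>UNIV. pmf (P s a) s' * v $ s')" for s a
  \<comment> \<open>Minimising \<open>- q s a\<close> over the finite action type yields a maximiser
    of \<open>q s a\<close>.\<close>
  define f where "f s = arg_min_on (\<lambda>a. - q s a) UNIV" for s
  have max: "q s a \<le> q s (f s)" for s a
    using arg_min_least[of UNIV a "\<lambda>a. - q s a"] by (simp add: f_def)
  fix \<pi> :: "'s \<Rightarrow> 'a pmf"
  show "bellman_policy P r \<gamma> \<pi> v \<le> bellman_policy P r \<gamma> (\<lambda>s. return_pmf (f s)) v"
    unfolding less_eq_vec_def
  proof
    fix s
    have "bellman_policy P r \<gamma> \<pi> v $ s = (\<Sum>a\<in>UNIV. pmf (\<pi> s) a * q s a)"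
      by (simp add: bellman_policy_component q_def)
    also have "\<dots> \<le> (\<Sum>a\<in>UNIV. pmf (\<pi> s) a * q s (f s))"
      by (intro sum_mono mult_left_mono max) simp
    also have "\<dots> = q s (f s)"
      by (simp add: sum_pmf_eq_1 flip: sum_distrib_right)
    also have "\<dots> = (\<Sum>a\<in>UNIV. pmf (return_pmf (f s)) a * q s a)"
      by (simp add: indicator_def if_distrib[of "\<lambda>x. x * _"] cong: if_cong)
    also have "\<dots> = bellman_policy P r \<gamma> (\<lambda>s. return_pmf (f s)) v $ s"
      by (simp only: bellman_policy_component q_def)
    finally show "bellman_policy P r \<gamma> \<pi> v $ s
        \<le> bellman_policy P r \<gamma> (\<lambda>s. return_pmf (f s)) v $ s" .
  qed
qed

text \<open>A dominating policy turns each supremum into an attained maximum, so boundedness above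
  is automatic.\<close>

lemma bellman_optimal_eq:
  assumes "\<And>\<pi>'. bellman_policy P r \<gamma> \<pi>' v \<le> bellman_policy P r \<gamma> \<pi> v"
  shows "bellman_optimal P r \<gamma> v = bellman_policy P r \<gamma> \<pi> v"
proof -
  have "(SUP \<pi>. bellman_policy P r \<gamma> \<pi> v $ s) = bellman_policy P r \<gamma> \<pi> v $ s" for s
    by (rule cSup_eq_maximum) (use assms in \<open>auto simp: less_eq_vec_def\<close>)
  then show ?thesis
    by (simp add: bellman_optimal_def vec_eq_iff)
qed

lemma bellman_optimal_attained:
  fixes P :: "'s::finite \<Rightarrow> 'a::finite \<Rightarrow> 's pmf"
  obtains f :: "'s \<Rightarrow> 'a" where
    "bellman_optimal P r \<gamma> v = bellman_policy P r \<gamma> (\<lambda>s. return_pmf (f s)) v"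
  by (metis deterministic_greedy_policy bellman_optimal_eq)

lemma bellman_policy_le_optimal: "bellman_policy P r \<gamma> \<pi> v \<le> bellman_optimal P r \<gamma> v"
  by (metis deterministic_greedy_policy bellman_optimal_eq)

section \<open>Contraction in the sup norm\<close>

text \<open>The policy greedy for \<open>u\<close> is one of the competitors at \<open>w\<close>.
  Using it at both points bounds the difference by that of one affine operator; exchanging
  \<open>u\<close> and \<open>w\<close> later gives the absolute value.\<close>

lemma bellman_optimal_diff_le:
  assumes "0 \<le> \<gamma>"
  shows "bellman_optimal P r \<gamma> u $ s - bellman_optimal P r \<gamma> w $ s \<le> \<gamma> * infnorm (u - w)"
proof -
  obtain f where f: "bellman_optimal P r \<gamma> u = bellman_policy P r \<gamma> (\<lambda>s. return_pmf (f s)) u"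
    by (rule bellman_optimal_attained)
  let ?\<pi> = "\<lambda>s. return_pmf (f s)"
  have "bellman_optimal P r \<gamma> u $ s - bellman_optimal P r \<gamma> w $ s
      \<le> bellman_policy P r \<gamma> ?\<pi> u $ s - bellman_policy P r \<gamma> ?\<pi> w $ s"
    using bellman_policy_le_optimal[of P r \<gamma> ?\<pi> w] by (simp add: f less_eq_vec_def)
  also have "\<dots> = (bellman_policy P r \<gamma> ?\<pi> u - bellman_policy P r \<gamma> ?\<pi> w) $ s"
    by simp
  also have "\<dots> \<le> \<gamma> * infnorm (u - w)"
    unfolding bellman_policy_diff
    using assms by (auto intro: mult_left_mono policy_kernel_le_infnorm)
  finally show ?thesis .
qed

lemma bellman_optimal_contraction:
  assumes "0 \<le> \<gamma>"
  shows "infnorm (bellman_optimal P r \<gamma> u - bellman_optimal P r \<gamma> w) \<le> \<gamma> * infnorm (u - w)"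
proof (rule infnorm_cart_le)
  fix s
  show "\<bar>(bellman_optimal P r \<gamma> u - bellman_optimal P r \<gamma> w) $ s\<bar> \<le> \<gamma> * infnorm (u - w)"
    using bellman_optimal_diff_le[OF assms, of P r u s w]
      bellman_optimal_diff_le[OF assms, of P r w s u]
    by (simp add: abs_le_iff infnorm_sub[of w u])
qed

lemma bellman_optimal_funpow_contraction:
  assumes "0 \<le> \<gamma>" and fixpoint: "bellman_optimal P r \<gamma> u = u"
  shows "infnorm (u - (bellman_optimal P r \<gamma> ^^ n) v) \<le> \<gamma> ^ n * infnorm (u - v)"
proof (induction n)
  case (Suc n)
  have "infnorm (u - (bellman_optimal P r \<gamma> ^^ Suc n) v)
      \<le> \<gamma> * infnorm (u - (bellman_optimal P r \<gamma> ^^ n) v)"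
    using bellman_optimal_contraction[OF assms(1), of P r u "(bellman_optimal P r \<gamma> ^^ n) v"]
    by (simp add: fixpoint)
  also have "\<dots> \<le> \<gamma> * (\<gamma> ^ n * infnorm (u - v))"
    by (intro mult_left_mono Suc assms)
  finally show ?case
    by (simp add: mult.assoc)
qed simp

text \<open>
  Policy improvement: among the finitely many deterministic policies take one maximising the sum
  of its values. The greedy policy for its value cannot improve on it, so that value is a fixed point.
\<close>

lemma bellman_optimal_policy_value_fixpoint:
  fixes P :: "'s::finite \<Rightarrow> 'a::finite \<Rightarrow> 's pmf"
  assumes \<gamma>: "0 \<le> \<gamma>" "\<gamma> < 1"
  obtains \<pi> where "bellman_optimal P r \<gamma> (policy_value P r \<gamma> \<pi>) = policy_value P r \<gamma> \<pi>"
proof -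
  define V where "V f = policy_value P r \<gamma> (\<lambda>s. return_pmf (f s))" for f :: "'s \<Rightarrow> 'a"
  define total where "total f = (\<Sum>s\<in>UNIV. V f $ s)" for f
  define f where "f = arg_min_on (\<lambda>f. - total f) UNIV"
  have max: "total g \<le> total f" for g
    using arg_min_least[of UNIV g "\<lambda>f. - total f"] by (simp add: f_def)
  let ?T = "bellman_optimal P r \<gamma>"
  obtain g where g: "?T (V f) = bellman_policy P r \<gamma> (\<lambda>s. return_pmf (g s)) (V f)"
    by (rule bellman_optimal_attained)
  have "bellman_policy P r \<gamma> (\<lambda>s. return_pmf (f s)) (V f) = V f"
    unfolding V_def by (rule bellman_policy_value[OF \<gamma>])
  then have le: "V f \<le> ?T (V f)"
    by (metis bellman_policy_le_optimal)
  \<comment> \<open>\<open>V f\<close> lies below its image under the policy \<open>g\<close>, hence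
    below the value of \<open>g\<close>.\<close>
  have improve: "V f \<le> V g"
    unfolding V_def[of g] using le g by (intro le_policy_value \<gamma>) simp
  have "?T (V f) \<le> bellman_policy P r \<gamma> (\<lambda>s. return_pmf (g s)) (V g)"
    unfolding g by (intro bellman_policy_mono \<gamma> improve)
  also have "\<dots> = V g"
    unfolding V_def by (rule bellman_policy_value[OF \<gamma>])
  finally have Tg: "?T (V f) \<le> V g" .
  \<comment> \<open>A strict gain in one component, with no loss elsewhere, would contradict the
    maximality of \<open>total f\<close>.\<close>
  have "V g $ s = V f $ s" for s
  proof (rule ccontr)
    assume "V g $ s \<noteq> V f $ s"
    with improve have "V f $ s < V g $ s"
      by (simp add: less_eq_vec_def order_less_le)
    with improve have "total f < total g"
      unfolding total_def by (intro sum_strict_mono_ex1) (auto simp: less_eq_vec_def)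
    with max[of g] show False
      by simp
  qed
  then have "V g = V f"
    by (simp add: vec_eq_iff)
  \<comment> \<open>The chain \<open>V f \<le> ?T (V f) \<le> V g = V f\<close> collapses.\<close>
  with le Tg have "?T (V f) = V f"
    by simp
  then show ?thesis
    unfolding V_def by (rule that)
qed

section \<open>The optimal value\<close>

text \<open>A fixed point of the optimal operator is mapped below itself by every policy operator,
  so it dominates every policy value. Being a policy value too, it is their maximum.\<close>

lemma optimal_value_attained:
  fixes P :: "'s::finite \<Rightarrow> 'a::finite \<Rightarrow> 's pmf"
  assumes "0 \<le> \<gamma>" "\<gamma> < 1"
  obtains \<pi> where "optimal_value P r \<gamma> = policy_value P r \<gamma> \<pi>"
    and "bellman_optimal P r \<gamma> (policy_value P r \<gamma> \<pi>) = policy_value P r \<gamma> \<pi>"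
    and "\<And>\<pi>'. policy_value P r \<gamma> \<pi>' \<le> policy_value P r \<gamma> \<pi>"
proof -
  obtain \<pi> where \<pi>: "bellman_optimal P r \<gamma> (policy_value P r \<gamma> \<pi>) = policy_value P r \<gamma> \<pi>"
    using bellman_optimal_policy_value_fixpoint[OF assms] .
  have max: "policy_value P r \<gamma> \<pi>' \<le> policy_value P r \<gamma> \<pi>" for \<pi>'
    using bellman_policy_le_optimal[of P r \<gamma> \<pi>' "policy_value P r \<gamma> \<pi>"]
    by (intro policy_value_le assms) (simp add: \<pi>)
  have "(SUP \<pi>. policy_value P r \<gamma> \<pi> $ s) = policy_value P r \<gamma> \<pi> $ s" for s
    by (rule cSup_eq_maximum) (use max in \<open>auto simp: less_eq_vec_def\<close>)
  then have "optimal_value P r \<gamma> = policy_value P r \<gamma> \<pi>"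
    by (simp add: optimal_value_def vec_eq_iff)
  from that[OF this \<pi> max] show ?thesis .
qed

lemma bellman_optimal_optimal_value:
  assumes "0 \<le> \<gamma>" "\<gamma> < 1"
  shows "bellman_optimal P r \<gamma> (optimal_value P r \<gamma>) = optimal_value P r \<gamma>"
  by (metis optimal_value_attained[OF assms])

lemma policy_value_le_optimal_value:
  assumes "0 \<le> \<gamma>" "\<gamma> < 1"
  shows "policy_value P r \<gamma> \<pi> \<le> optimal_value P r \<gamma>"
  by (metis optimal_value_attained[OF assms])

section \<open>Squeezing iterates and \<lambda>-returns\<close>

lemma bellman_policy_funpow_between:
  assumes \<gamma>: "0 \<le> \<gamma>" "\<gamma> < 1" and w: "w \<le> bellman_policy P r \<gamma> \<pi> w" and "m \<ge> 1"
  shows "bellman_policy P r \<gamma> \<pi> w \<le> (bellman_policy P r \<gamma> \<pi> ^^ m) w"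
    and "(bellman_policy P r \<gamma> \<pi> ^^ m) w \<le> policy_value P r \<gamma> \<pi>"
proof -
  let ?T = "bellman_policy P r \<gamma> \<pi>"
  have "?T w \<le> (?T ^^ m) w \<and> (?T ^^ m) w \<le> policy_value P r \<gamma> \<pi>"
    using \<open>m \<ge> 1\<close>
  proof (induction m rule: dec_induct)
    case base
    show ?case
      using bellman_policy_mono[OF \<gamma>(1) le_policy_value[OF \<gamma> w], of P r \<pi>]
      by (simp add: bellman_policy_value[OF \<gamma>])
  next
    \<comment> \<open>Applying the monotone \<open>?T\<close> to
      \<open>w \<le> (?T ^^ m) w \<le> policy_value P r \<gamma> \<pi>\<close> gives both bounds for
      \<open>Suc m\<close>, the value being fixed by \<open>?T\<close>.\<close>
    case (step m)
    then have "w \<le> (?T ^^ m) w" "(?T ^^ m) w \<le> policy_value P r \<gamma> \<pi>"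
      using w by (auto intro: order_trans)
    then show ?case
      using bellman_policy_mono[OF \<gamma>(1), of _ _ P r \<pi>] bellman_policy_value[OF \<gamma>, of P r \<pi>]
      by (metis comp_apply funpow.simps(2))
  qed
  then show "?T w \<le> (?T ^^ m) w" "(?T ^^ m) w \<le> policy_value P r \<gamma> \<pi>"
    by simp_all
qed

text \<open>After subtracting \<open>w\<close>, the claim is \<open>d \<le> y \<le> z\<close>: both
  \<open>y\<close> and \<open>z\<close> are resolvents applied to the Bellman residual
  \<open>d \<ge> 0\<close>, with discounts \<open>\<gamma> * l\<close> and \<gamma>, so the larger
  discount gives the larger vector.\<close>

lemma lambda_return_between:
  fixes P :: "'s::finite \<Rightarrow> 'a::finite \<Rightarrow> 's pmf"
  assumes \<gamma>: "0 \<le> \<gamma>" "\<gamma> < 1" and l: "0 \<le> l" "l \<le> 1"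
    and w: "w \<le> bellman_policy P r \<gamma> \<pi> w"
  shows "bellman_policy P r \<gamma> \<pi> w \<le> lambda_return P r \<gamma> l \<pi> w"
    and "lambda_return P r \<gamma> l \<pi> w \<le> policy_value P r \<gamma> \<pi>"
proof -
  let ?K = "policy_kernel P \<pi>"
  define d where "d = bellman_policy P r \<gamma> \<pi> w - w"
  define y where "y = matrix_inv (mat 1 - (\<gamma> * l) *\<^sub>R ?K) *v d"
  define z where "z = policy_value P r \<gamma> \<pi> - w"
  have c: "0 \<le> \<gamma> * l" "\<gamma> * l < 1"
    using \<gamma> l mult_left_mono[of l 1 \<gamma>] by auto
  have scaleR_nonneg: "0 \<le> b *\<^sub>R x" if "0 \<le> b" "0 \<le> x" for b and x :: "real ^ 's"
    using that by (simp add: less_eq_vec_def)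
  have d: "0 \<le> d"
    using w by (simp add: d_def)
  have y: "y = d + (\<gamma> * l) *\<^sub>R (?K *v y)"
    unfolding y_def by (rule resolvent_solution[OF c])
  then have "(\<gamma> * l) *\<^sub>R (?K *v y) \<le> y"
    using d by (metis le_add_same_cancel2)
  then have "0 \<le> y"
    by (rule minimum_principle[OF c])
  then have "0 \<le> (\<gamma> * l) *\<^sub>R (?K *v y)"
    by (intro scaleR_nonneg policy_kernel_nonneg_vector c)
  then have "d \<le> y"
    using y by (metis le_add_same_cancel1)
  then show "bellman_policy P r \<gamma> \<pi> w \<le> lambda_return P r \<gamma> l \<pi> w"
    by (simp add: lambda_return_def d_def y_def algebra_simps)
  have z: "z = d + \<gamma> *\<^sub>R (?K *v z)"
    using bellman_policy_diff[of P r \<gamma> \<pi> "policy_value P r \<gamma> \<pi>" w]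
    by (simp add: z_def d_def bellman_policy_value[OF \<gamma>] algebra_simps)
  have "0 \<le> z"
    using le_policy_value[OF \<gamma> w] by (simp add: z_def)
  \<comment> \<open>Subtract the two fixed-point equations and split \<gamma> as
    \<open>\<gamma> * l + \<gamma> * (1 - l)\<close>. The last summand is a nonnegative source term,
    so the minimum principle with discount \<open>\<gamma> * l\<close> applies.\<close>
  have "z - y = (\<gamma> * l) *\<^sub>R (?K *v (z - y)) + (\<gamma> * (1 - l)) *\<^sub>R (?K *v z)"
    by (subst z, subst y) (simp add: matrix_vector_mult_diff_distrib algebra_simps)
  moreover have "0 \<le> (\<gamma> * (1 - l)) *\<^sub>R (?K *v z)"
    using \<open>0 \<le> z\<close> \<gamma> l by (intro scaleR_nonneg policy_kernel_nonneg_vector) auto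
  ultimately have "(\<gamma> * l) *\<^sub>R (?K *v (z - y)) \<le> z - y"
    by (metis le_add_same_cancel1)
  then have "0 \<le> z - y"
    by (rule minimum_principle[OF c])
  then show "lambda_return P r \<gamma> l \<pi> w \<le> policy_value P r \<gamma> \<pi>"
    by (simp add: lambda_return_def d_def[symmetric] y_def[symmetric] z_def algebra_simps)
qed

theorem proposition2:
  fixes P :: "'s::finite \<Rightarrow> 'a::finite \<Rightarrow> 's pmf"
    and r :: "'s \<Rightarrow> 'a \<Rightarrow> real"
    and Rmin Rmax \<gamma> l :: real
    and h m :: nat
    and v :: "real ^ 's"
    and \<pi> :: "'s \<Rightarrow> 'a pmf"
  assumes "\<And>s a. r s a \<in> {Rmin..Rmax}"
    and "\<gamma> \<in> {0<..<1}"
    and "h \<noteq> 0"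
    and "\<pi> \<in> greedy_policies P r \<gamma> h v"
    and "greedy_consistent P r \<gamma> h v \<pi>"
    and "m \<ge> 1"
    and "l \<in> {0..1}"
  shows "infnorm (optimal_value P r \<gamma>
            - (bellman_policy P r \<gamma> \<pi> ^^ m) ((bellman_optimal P r \<gamma> ^^ (h - 1)) v))
           \<le> \<gamma> ^ h * infnorm (optimal_value P r \<gamma> - v)
       \<and> infnorm (optimal_value P r \<gamma>
            - lambda_return P r \<gamma> l \<pi> ((bellman_optimal P r \<gamma> ^^ (h - 1)) v))
           \<le> \<gamma> ^ h * infnorm (optimal_value P r \<gamma> - v)"
proof -
  let ?w = "(bellman_optimal P r \<gamma> ^^ (h - 1)) v"
  let ?v = "optimal_value P r \<gamma>"
  have \<gamma>: "0 \<le> \<gamma>" "\<gamma> < 1" and l: "0 \<le> l" "l \<le> 1"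
    using assms by auto
  have w: "?w \<le> bellman_policy P r \<gamma> \<pi> ?w"
    using assms(5) by (simp add: greedy_consistent_def)
  have greedy: "bellman_policy P r \<gamma> \<pi> ?w = (bellman_optimal P r \<gamma> ^^ h) v"
    using assms(4) by (simp add: greedy_policies_def)
  have bound: "infnorm (?v - x) \<le> \<gamma> ^ h * infnorm (?v - v)"
    if x: "bellman_policy P r \<gamma> \<pi> ?w \<le> x" "x \<le> policy_value P r \<gamma> \<pi>" for x
  proof -
    have "infnorm (?v - x) \<le> infnorm (?v - bellman_policy P r \<gamma> \<pi> ?w)"
    proof (rule infnorm_cart_le)
      fix s
      \<comment> \<open>Both differences from the optimal value are nonnegative, so the absolute
        values can be compared directly.\<close>
      have "bellman_policy P r \<gamma> \<pi> ?w $ s \<le> x $ s" "x $ s \<le> ?v $ s"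
        using x policy_value_le_optimal_value[OF \<gamma>, of P r \<pi>]
        by (auto simp: less_eq_vec_def intro: order_trans)
      then show "\<bar>(?v - x) $ s\<bar> \<le> infnorm (?v - bellman_policy P r \<gamma> \<pi> ?w)"
        using component_le_infnorm_cart[of "?v - bellman_policy P r \<gamma> \<pi> ?w" s] by simp
    qed
    also have "\<dots> \<le> \<gamma> ^ h * infnorm (?v - v)"
      unfolding greedy
      by (intro bellman_optimal_funpow_contraction bellman_optimal_optimal_value \<gamma>)
    finally show ?thesis .
  qed
  show ?thesis
    using bound[OF bellman_policy_funpow_between[OF \<gamma> w \<open>m \<ge> 1\<close>]]
      bound[OF lambda_return_between[OF \<gamma> l w]] by blast
qed

end
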